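(* Fix network weights $\theta\in\mathbb R^{n_\theta}$ and let, for each $(\bm r_0,\bm v_0,m_0)\in\Omega$, the final time $t_f^*>t_0$, the network trajectory $\bm x_{\mathrm{NN}}(t)=(\bm r(t),\bm v(t),m(t))$ and the commanded control history $\bm u^*_{\mathrm{NN}}(t)=(T^*(t),\hat{\bm\imath}^*_\theta(t))$, $t\in[t_0,t_f^*]$, be as constructed in the context. Let $\bm x_{\mathrm{true}}$ be the solution on $[t_0,t_f^*]$ of $$\dot{\bm x}=\bm f(\bm x,\bm u^*_{\mathrm{NN}}(t)),\qquad \bm x(t_0)=(\bm r_0,\bm v_0,m_0).$$ Define the state-dynamics residual along the network trajectory by $\bm\varepsilon_x(t)=[\mathrm{res}_r(t);\mathrm{res}_v(t);\mathrm{res}_m(t)]\in\mathbb R^7$, where $$\mathrm{res}_r=\dot{\bm r}-\bm v,\qquad \mathrm{res}_v=\dot{\bm v}-\Big(\frac{T^*}{m}\hat{\bm\imath}^*_\theta+\bm g\Big),\qquad \mathrm{res}_m=\dot m+\frac{T^*}{I_{sp}g_0},$$ and let $\varepsilon_x^\infty=\sup_{t\in[t_0,t_f^*]}\|\bm\varepsilon_x(t)\|_2$. Assume that the mass constraint holds: for every $(\bm r_0,\bm v_0,m_0)\in\Omega$ and every $t\in[t_0,t_f^*]$, the mass components of both $\bm x_{\mathrm{NN}}(t)$ and $\bm x_{\mathrm{true}}(t)$ lie in $[m_{\mathrm{dry}},m_0]$, where $m_{\mathrm{dry}}>0$. Put $$L_f=1+\frac{T_{\max}}{m_{\mathrm{dry}}^2}.$$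 Then: (i) For every admissible control $\bm u=(T,\hat{\bm\imath}_\theta)$ with $0\le T\le T_{\max}$, $\|\hat{\bm\imath}_\theta\|_2=1$, the map $\bm f(\cdot,\bm u)$ is Lipschitz in $\bm x$ with constant $L_f$, i.e. $\|\bm f(\bm x,\bm u)-\bm f(\bm x',\bm u)\|_2\le L_f\|\bm x-\bm x'\|_2$ for all states $\bm x,\bm x'$ whose mass components are at least $m_{\mathrm{dry}}$. (ii) For every $(\bm r_0,\bm v_0,m_0)\in\Omega$ and every $t\in[t_0,t_f^*]$, $$\|\bm x_{\mathrm{NN}}(t)-\bm x_{\mathrm{true}}(t)\|_2\le\varepsilon_x^\infty\,\frac{e^{L_f(t-t_0)}-1}{L_f}.$$
   Context: **Dynamics.** $I_{sp},g_0,T_{\max},m_{\mathrm{dry}},g_{\mathrm{moon}}>0$ are fixed constants, $\bm g=[0,0,-g_{\mathrm{moon}}]^\top$, $t_0\in\mathbb R$ is the initial time. For a state $\bm x=(\bm r,\bm v,m)\in\mathbb R^3\times\mathbb R^3\times\mathbb R=\mathbb R^7$ and control $\bm u=(T,\hat{\bm\imath}_\theta)\in\mathbb R\times\mathbb R^3$, $$\bm f(\bm x,\bm u)=\Big(\bm v,\ \frac{T}{m}\hat{\bm\imath}_\theta+\bm g,\ -\frac{T}{I_{sp}g_0}\Big).$$ **Initial states.** $\Omega=\{(\bm r_0,\bm v_0,m_0):\bm r_0\in[\bm r_0^{\mathrm{lo}},\bm r_0^{\mathrm{hi}}],\bm v_0\in[\bm v_0^{\mathrm{lo}},\bm v_0^{\mathrm{hi}}],m_0\in[m_0^{\mathrm{lo}},m_0^{\mathrm{hi}}]\}$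 is a box (componentwise bounds, lower bounds strictly less than upper bounds, $m_0^{\mathrm{lo}}>0$) with center $(\bm r_{0,\mathrm{center}},\bm v_{0,\mathrm{center}},m_{0,\mathrm{center}})$. The normalized initial state $(\bm r_{0,\mathrm{norm}},\bm v_{0,\mathrm{norm}},m_{0,\mathrm{norm}})\in\mathbb R^7$ is obtained by subtracting the center and dividing by the half-width in each coordinate. $\bm r_f,\bm v_f\in\mathbb R^3$ are fixed terminal position and velocity; $t_f^{\min}>0$ is a fixed constant. **Networks.** Two fully connected feedforward networks are used, each with two hidden layers with $\tanh$ activations and an affine output layer: the condition encoder $\mathrm{NN}_{\mathrm{cond}}:\mathbb R^7\to\mathbb R^7$ (hidden width 32) and the main trunk $\mathbb R^8\to\mathbb R^9$ (hidden width 64). $\theta\in\mathbb R^{n_\theta}$, $n_\theta=6864$, collects all weights and biases. The condition encoder outputs $(\bm a_0,\bm a_1,\tau)=\mathrm{NN}_{\mathrm{cond}}(\bm r_{0,\mathrm{norm}},\bm v_{0,\mathrm{norm}},m_{0,\mathrm{norm}})$ with $\bm a_0,\bm a_1\in\mathbb R^3$, $\tau\in\mathbb R$. The main trunk, evaluated at $(\tilde t,\bm r_{0,\mathrm{norm}},\bm v_{0,\mathrm{norm}},m_{0,\mathrm{norm}})$, outputs $\mathrm{NN}_r(t),\mathrm{NN}_v(t)\in\mathbb R^3$ and $\mathrm{NN}_m(t),\mathrm{NN}_\lambda(t)\in\mathbb R$ (and one further scalar not used here). **Scale constants.** $s_{tf}=60$, $s_r=0.4\max|\bm r_{0,\mathrm{center}}-\bm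 r_f|$, $s_v=2.0\max|\bm v_{0,\mathrm{center}}-\bm v_f|$ (maximum absolute component), $s_m=0.5\frac{T_{\max}}{I_{sp}g_0}s_{tf}$, $s_v^\lambda=0.5\,m_{0,\mathrm{center}}T_{\max}$, $s_\lambda=0.5\,T_{\max}I_{sp}g_0$. **Constructions.** $t_f^*=t_f^{\min}+s_{tf}\ln(1+e^\tau)$, with $t_f^*>t_0$ a standing requirement, and $\tilde t=(t-t_0)/(t_f^*-t_0)$. For $t\in[t_0,t_f^*]$, $$\bm r(t)=\bm r_0+\tilde t(\bm r_f-\bm r_0)+\tilde t(1-\tilde t)\,\mathrm{NN}_r(t)\,s_r,\quad \bm v(t)=\bm v_0+\tilde t(\bm v_f-\bm v_0)+\tilde t(1-\tilde t)\,\mathrm{NN}_v(t)\,s_v,$$ $$m(t)=m_0+\tilde t\,\mathrm{NN}_m(t)\,s_m,\quad \lambda_m(t)=(1-\tilde t)\,\mathrm{NN}_\lambda(t)\,s_\lambda,\quad \bm\lambda_v(t)=s_v^\lambda(\bm a_0-\bm a_1\tilde t),$$ $$\hat{\bm\imath}_\theta^*(t)=-\frac{\bm\lambda_v(t)}{\|\bm\lambda_v(t)\|_2},\qquad T^*(t)=\mathrm{clip}\Big(\tfrac12\Big(\tfrac{\|\bm\lambda_v(t)\|_2}{m(t)}+\tfrac{\lambda_m(t)}{I_{sp}g_0}\Big),0,T_{\max}\Big),$$ where $\mathrm{clip}(y,0,T_{\max})=\min(\max(y,0),T_{\max})$. A dot denotes the derivative with respect to $t$. **Convention.** The event $\bm\lambda_v(t)=\bm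 0$, where the direction formula is undefined, is treated as negligible: $\bm\lambda_v$ is taken not to be identically zero on $[t_0,t_f^*]$ (so, being affine in $t$, it vanishes for at most one $t$); that time, if any, is excluded from the supremum defining $\varepsilon_x^\infty$, and the differential equation for $\bm x_{\mathrm{true}}$ is understood with $\bm x_{\mathrm{true}}$ absolutely continuous and the equation holding for almost every $t$. *)

theory Defs
  imports "HOL-Analysis.Analysis"
begin

text \<open>
  A state is a triple \<open>(r, v, m)\<close> and a control a pair \<open>(T, i)\<close>.  The norm that HOL-Analysis puts
  on products of Euclidean spaces is \<open>sqrt (norm r ^ 2 + norm v ^ 2 + norm m ^ 2)\<close>, that is, the
  2-norm of the 7-dimensional state vector.
\<close>

type_synonym state = "(real^3) \<times> (real^3) \<times> real"
type_synonym control = "real \<times> (real^3)"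

abbreviation pos_of :: "state \<Rightarrow> real^3" where "pos_of x \<equiv> fst x"
abbreviation vel_of :: "state \<Rightarrow> real^3" where "vel_of x \<equiv> fst (snd x)"
abbreviation mass_of :: "state \<Rightarrow> real" where "mass_of x \<equiv> snd (snd x)"

record problem =
  I_sp :: real
  g_0 :: real
  T_max :: real
  m_dry :: real
  g_moon :: real
  t_0 :: real
  t_f_min :: real
  r_lo :: "real^3"
  r_hi :: "real^3"
  v_lo :: "real^3"
  v_hi :: "real^3"
  m_lo :: real
  m_hi :: real
  r_f :: "real^3"
  v_f :: "real^3"

definition valid_problem :: "problem \<Rightarrow> bool" where
  "valid_problem P \<longleftrightarrow>
     0 < I_sp P \<and> 0 < g_0 P \<and> 0 < T_max P \<and> 0 < m_dry P \<and> 0 < g_moon P \<and> 0 < t_f_min P \<and>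
     (\<forall>i. r_lo P $ i < r_hi P $ i) \<and> (\<forall>i. v_lo P $ i < v_hi P $ i) \<and>
     m_lo P < m_hi P \<and> 0 < m_lo P"

definition grav :: "problem \<Rightarrow> real^3" where
  "grav P = vector [0, 0, - g_moon P]"

definition dynamics :: "problem \<Rightarrow> state \<Rightarrow> control \<Rightarrow> state" where
  "dynamics P x u = (case x of (r, v, m) \<Rightarrow> case u of (T, i) \<Rightarrow>
     (v, (T / m) *\<^sub>R i + grav P, - T / (I_sp P * g_0 P)))"

definition initial_states :: "problem \<Rightarrow> state set" where
  "initial_states P = {r_lo P..r_hi P} \<times> {v_lo P..v_hi P} \<times> {m_lo P..m_hi P}"

definition r_center :: "problem \<Rightarrow> real^3" where "r_center P = midpoint (r_lo P) (r_hi P)"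
definition v_center :: "problem \<Rightarrow> real^3" where "v_center P = midpoint (v_lo P) (v_hi P)"
definition m_center :: "problem \<Rightarrow> real" where "m_center P = midpoint (m_lo P) (m_hi P)"

definition normalize_state :: "problem \<Rightarrow> state \<Rightarrow> state" where
  "normalize_state P x = (case x of (r, v, m) \<Rightarrow>
     (\<chi> i. (r $ i - r_center P $ i) / ((r_hi P $ i - r_lo P $ i) / 2),
      \<chi> i. (v $ i - v_center P $ i) / ((v_hi P $ i - v_lo P $ i) / 2),
      (m - m_center P) / ((m_hi P - m_lo P) / 2)))"

type_synonym ('i, 'o) layer = "(real^'i^'o) \<times> (real^'o)"
type_synonym ('i, 'h, 'o) mlp = "('i, 'h) layer \<times> ('h, 'h) layer \<times> ('h, 'o) layer"

text \<open>The first component is the condition encoder, the second one the main trunk.\<close>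

type_synonym weights = "(7, 32, 7) mlp \<times> (8, 64, 9) mlp"

lemma DIM_weights: "DIM(weights) = 6864"
  by simp

definition affine_layer :: "('i::finite, 'o::finite) layer \<Rightarrow> real^'i \<Rightarrow> real^'o" where
  "affine_layer l x = fst l *v x + snd l"

definition tanh_vec :: "real^'n \<Rightarrow> real^'n" where
  "tanh_vec y = (\<chi> i. tanh (y $ i))"

definition mlp_eval :: "('i::finite, 'h::finite, 'o::finite) mlp \<Rightarrow> real^'i \<Rightarrow> real^'o" where
  "mlp_eval N x = (case N of (l1, l2, l3) \<Rightarrow>
     affine_layer l3 (tanh_vec (affine_layer l2 (tanh_vec (affine_layer l1 x)))))"

definition encoder_output :: "problem \<Rightarrow> weights \<Rightarrow> state \<Rightarrow> real^7" where
  "encoder_output P \<theta> x0 = (case normalize_state P x0 of (r, v, m) \<Rightarrow>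
     mlp_eval (fst \<theta>) (vector [r $ 1, r $ 2, r $ 3, v $ 1, v $ 2, v $ 3, m]))"

definition a_0 :: "problem \<Rightarrow> weights \<Rightarrow> state \<Rightarrow> real^3" where
  "a_0 P \<theta> x0 = (let y = encoder_output P \<theta> x0 in vector [y $ 1, y $ 2, y $ 3])"

definition a_1 :: "problem \<Rightarrow> weights \<Rightarrow> state \<Rightarrow> real^3" where
  "a_1 P \<theta> x0 = (let y = encoder_output P \<theta> x0 in vector [y $ 4, y $ 5, y $ 6])"

definition tau :: "problem \<Rightarrow> weights \<Rightarrow> state \<Rightarrow> real" where
  "tau P \<theta> x0 = encoder_output P \<theta> x0 $ 7"

text \<open>\<open>infnorm\<close> is the maximum absolute component.\<close>

definition s_tf :: real where "s_tf = 60"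
definition s_r :: "problem \<Rightarrow> real" where "s_r P = 0.4 * infnorm (r_center P - r_f P)"
definition s_v :: "problem \<Rightarrow> real" where "s_v P = 2.0 * infnorm (v_center P - v_f P)"
definition s_m :: "problem \<Rightarrow> real" where "s_m P = 0.5 * (T_max P / (I_sp P * g_0 P)) * s_tf"
definition s_lambda_v :: "problem \<Rightarrow> real" where "s_lambda_v P = 0.5 * m_center P * T_max P"
definition s_lambda :: "problem \<Rightarrow> real" where "s_lambda P = 0.5 * T_max P * I_sp P * g_0 P"

definition t_f :: "problem \<Rightarrow> weights \<Rightarrow> state \<Rightarrow> real" where
  "t_f P \<theta> x0 = t_f_min P + s_tf * ln (1 + exp (tau P \<theta> x0))"

definition t_norm :: "problem \<Rightarrow> weights \<Rightarrow> state \<Rightarrow> real \<Rightarrow> real" where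
  "t_norm P \<theta> x0 t = (t - t_0 P) / (t_f P \<theta> x0 - t_0 P)"

definition trunk_output :: "problem \<Rightarrow> weights \<Rightarrow> state \<Rightarrow> real \<Rightarrow> real^9" where
  "trunk_output P \<theta> x0 t = (case normalize_state P x0 of (r, v, m) \<Rightarrow>
     mlp_eval (snd \<theta>)
       (vector [t_norm P \<theta> x0 t, r $ 1, r $ 2, r $ 3, v $ 1, v $ 2, v $ 3, m]))"

definition NN_r :: "problem \<Rightarrow> weights \<Rightarrow> state \<Rightarrow> real \<Rightarrow> real^3" where
  "NN_r P \<theta> x0 t = (let y = trunk_output P \<theta> x0 t in vector [y $ 1, y $ 2, y $ 3])"

definition NN_v :: "problem \<Rightarrow> weights \<Rightarrow> state \<Rightarrow> real \<Rightarrow> real^3" where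
  "NN_v P \<theta> x0 t = (let y = trunk_output P \<theta> x0 t in vector [y $ 4, y $ 5, y $ 6])"

definition NN_m :: "problem \<Rightarrow> weights \<Rightarrow> state \<Rightarrow> real \<Rightarrow> real" where
  "NN_m P \<theta> x0 t = trunk_output P \<theta> x0 t $ 7"

text \<open>Component 9 of the trunk output is not used.\<close>

definition NN_lambda :: "problem \<Rightarrow> weights \<Rightarrow> state \<Rightarrow> real \<Rightarrow> real" where
  "NN_lambda P \<theta> x0 t = trunk_output P \<theta> x0 t $ 8"

definition r_NN :: "problem \<Rightarrow> weights \<Rightarrow> state \<Rightarrow> real \<Rightarrow> real^3" where
  "r_NN P \<theta> x0 t = (let s = t_norm P \<theta> x0 t in
     pos_of x0 + s *\<^sub>R (r_f P - pos_of x0) + (s * (1 - s) * s_r P) *\<^sub>R NN_r P \<theta> x0 t)"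

definition v_NN :: "problem \<Rightarrow> weights \<Rightarrow> state \<Rightarrow> real \<Rightarrow> real^3" where
  "v_NN P \<theta> x0 t = (let s = t_norm P \<theta> x0 t in
     vel_of x0 + s *\<^sub>R (v_f P - vel_of x0) + (s * (1 - s) * s_v P) *\<^sub>R NN_v P \<theta> x0 t)"

definition m_NN :: "problem \<Rightarrow> weights \<Rightarrow> state \<Rightarrow> real \<Rightarrow> real" where
  "m_NN P \<theta> x0 t = mass_of x0 + t_norm P \<theta> x0 t * NN_m P \<theta> x0 t * s_m P"

definition x_NN :: "problem \<Rightarrow> weights \<Rightarrow> state \<Rightarrow> real \<Rightarrow> state" where
  "x_NN P \<theta> x0 t = (r_NN P \<theta> x0 t, v_NN P \<theta> x0 t, m_NN P \<theta> x0 t)"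

definition lambda_m :: "problem \<Rightarrow> weights \<Rightarrow> state \<Rightarrow> real \<Rightarrow> real" where
  "lambda_m P \<theta> x0 t = (1 - t_norm P \<theta> x0 t) * NN_lambda P \<theta> x0 t * s_lambda P"

definition lambda_v :: "problem \<Rightarrow> weights \<Rightarrow> state \<Rightarrow> real \<Rightarrow> real^3" where
  "lambda_v P \<theta> x0 t = s_lambda_v P *\<^sub>R (a_0 P \<theta> x0 - t_norm P \<theta> x0 t *\<^sub>R a_1 P \<theta> x0)"

text \<open>Takes the junk value \<open>0\<close> at a time where \<open>lambda_v\<close> vanishes; such times are excluded from
  the supremum below and form a null set for the differential equation.\<close>

definition thrust_dir :: "problem \<Rightarrow> weights \<Rightarrow> state \<Rightarrow> real \<Rightarrow> real^3" where
  "thrust_dir P \<theta> x0 t = - (lambda_v P \<theta> x0 t /\<^sub>R norm (lambda_v P \<theta> x0 t))"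

definition clip :: "real \<Rightarrow> real \<Rightarrow> real \<Rightarrow> real" where
  "clip y lo hi = min (max y lo) hi"

definition thrust :: "problem \<Rightarrow> weights \<Rightarrow> state \<Rightarrow> real \<Rightarrow> real" where
  "thrust P \<theta> x0 t =
     clip (1/2 * (norm (lambda_v P \<theta> x0 t) / m_NN P \<theta> x0 t + lambda_m P \<theta> x0 t / (I_sp P * g_0 P)))
       0 (T_max P)"

definition u_NN :: "problem \<Rightarrow> weights \<Rightarrow> state \<Rightarrow> real \<Rightarrow> control" where
  "u_NN P \<theta> x0 t = (thrust P \<theta> x0 t, thrust_dir P \<theta> x0 t)"

definition flight_interval :: "problem \<Rightarrow> weights \<Rightarrow> state \<Rightarrow> real set" where
  "flight_interval P \<theta> x0 = {t_0 P..t_f P \<theta> x0}"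

definition res_r :: "problem \<Rightarrow> weights \<Rightarrow> state \<Rightarrow> real \<Rightarrow> real^3" where
  "res_r P \<theta> x0 t =
     vector_derivative (r_NN P \<theta> x0) (at t within flight_interval P \<theta> x0) - v_NN P \<theta> x0 t"

definition res_v :: "problem \<Rightarrow> weights \<Rightarrow> state \<Rightarrow> real \<Rightarrow> real^3" where
  "res_v P \<theta> x0 t =
     vector_derivative (v_NN P \<theta> x0) (at t within flight_interval P \<theta> x0)
       - ((thrust P \<theta> x0 t / m_NN P \<theta> x0 t) *\<^sub>R thrust_dir P \<theta> x0 t + grav P)"

definition res_m :: "problem \<Rightarrow> weights \<Rightarrow> state \<Rightarrow> real \<Rightarrow> real" where
  "res_m P \<theta> x0 t =
     vector_derivative (m_NN P \<theta> x0) (at t within flight_interval P \<theta> x0)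
       + thrust P \<theta> x0 t / (I_sp P * g_0 P)"

definition residual :: "problem \<Rightarrow> weights \<Rightarrow> state \<Rightarrow> real \<Rightarrow> state" where
  "residual P \<theta> x0 t = (res_r P \<theta> x0 t, res_v P \<theta> x0 t, res_m P \<theta> x0 t)"

text \<open>
  The supremum is a real one.  The set is nonempty when \<open>lambda_v\<close> is not identically zero, and
  bounded above when \<open>m_NN\<close> stays above a positive constant, since then the derivatives are
  continuous on a compact interval, the thrust lies in \<open>[0, T_max]\<close> and the direction has norm at
  most 1.
\<close>

definition eps_inf :: "problem \<Rightarrow> weights \<Rightarrow> state \<Rightarrow> real" where
  "eps_inf P \<theta> x0 =
     (SUP t\<in>{t \<in> flight_interval P \<theta> x0. lambda_v P \<theta> x0 t \<noteq> 0}. norm (residual P \<theta> x0 t))"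

text \<open>
  Absolute continuity on \<open>[a, b]\<close>; \<open>D division_of \<Union>D\<close> says that \<open>D\<close> is a finite family of
  nonempty compact intervals with pairwise disjoint interiors.
\<close>

definition abs_continuous_on_interval ::
    "real \<Rightarrow> real \<Rightarrow> (real \<Rightarrow> 'a::real_normed_vector) \<Rightarrow> bool" where
  "abs_continuous_on_interval a b x \<longleftrightarrow>
     (\<forall>e>0. \<exists>d>0. \<forall>D. D division_of \<Union>D \<and> \<Union>D \<subseteq> {a..b} \<and> (\<Sum>K\<in>D. Sup K - Inf K) < d \<longrightarrow>
        (\<Sum>K\<in>D. norm (x (Sup K) - x (Inf K))) < e)"

definition is_true_trajectory :: "problem \<Rightarrow> weights \<Rightarrow> state \<Rightarrow> (real \<Rightarrow> state) \<Rightarrow> bool" where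
  "is_true_trajectory P \<theta> x0 x \<longleftrightarrow>
     abs_continuous_on_interval (t_0 P) (t_f P \<theta> x0) x \<and>
     x (t_0 P) = x0 \<and>
     (AE t\<in>flight_interval P \<theta> x0 in lebesgue.
        (x has_vector_derivative dynamics P (x t) (u_NN P \<theta> x0 t))
          (at t within flight_interval P \<theta> x0))"

definition L_f :: "problem \<Rightarrow> real" where
  "L_f P = 1 + T_max P / (m_dry P)\<^sup>2"

end

theory Submission
  imports Defs
begin

text \<open>
  Both trajectories start at the same state, so only their rates have to be compared.  By the
  definition of the residual, the network trajectory solves the controlled equation up to an error
  term, \<open>x_NN' = f (x_NN, u) + residual\<close>, while the true trajectory solves
  \<open>x' = f (x, u)\<close>, both with the same open-loop control \<open>u\<close>.  Away from a null set the residual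
  has norm at most \<open>eps_inf\<close> and \<open>f (\<cdot>, u)\<close> is Lipschitz with constant \<open>L_f\<close>, so that
  \<open>norm (x_NN' - x') \<le> L_f * norm (x_NN - x) + eps_inf\<close>, and Gronwall's inequality gives the bound.
  The Lipschitz constant (\<open>dynamics_lipschitz\<close>) comes from the two places where the state enters
  \<open>f\<close>: the velocity contributes the constant 1 to the position rate, and the mass contributes to
  the acceleration \<open>T / m\<close>, whose derivative in \<open>m\<close> is at most \<open>T_max / m_dry^2\<close> in absolute value.

  Two analytic points need care.  The true trajectory is only absolutely continuous and satisfies its
  equation almost everywhere; Gronwall's inequality is therefore used in integral form, which
  requires that an absolutely continuous function is the integral of its almost everywhere
  derivative (\<open>fundamental_theorem_of_calculus_abs_continuous\<close>).  In the Henstock--Kurzweil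
  setting this holds because the gauge can be chosen so fine on the exceptional null set that the
  tagged intervals with tags there have small total length.

  Secondly, \<open>eps_inf\<close> is a supremum of real numbers and bounds the residual only if the residual is
  bounded (\<open>norm_residual_le_eps_inf\<close>).  Networks with \<open>tanh\<close> activations are continuously
  differentiable in time, so on the compact flight interval the rate of \<open>x_NN\<close> is bounded; the
  thrust is clipped and the mass stays above \<open>m_dry\<close>, so \<open>f (x_NN, u)\<close> is bounded as well.  The
  times where \<open>lambda_v\<close> vanishes, which the supremum omits, form a finite set because \<open>lambda_v\<close>
  is affine in time and not identically zero (\<open>finite_lambda_v_zeros\<close>).
\<close>

section \<open>Absolutely continuous functions are integrals of their derivatives\<close>

text \<open>
  Members of a division overlap at most in endpoints, so their lengths add up to the measure of
  their union.
\<close>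

lemma sum_lengths_division_le_measure:
  fixes D :: "real set set"
  assumes D: "D division_of \<Union>D" and sub: "\<Union>D \<subseteq> U" and meas: "U \<in> lmeasurable"
  shows "(\<Sum>K\<in>D. Sup K - Inf K) \<le> measure lebesgue U"
proof -
  have cb: "\<exists>u v. K = cbox u v \<and> u \<le> v" if "K \<in> D" for K
    using division_ofD(3,4)[OF D that] by (metis box_ne_empty(1) box_real(2) atLeastatMost_empty_iff)
  have eq: "Sup K - Inf K = measure lebesgue K" if "K \<in> D" for K
    using cb[OF that] by auto
  have neg: "negligible (S \<inter> T)" if ST: "S \<in> D" "T \<in> D" "S \<noteq> T" for S T
  proof -
    obtain u v u' v' where *: "S = cbox u v" "T = cbox u' v'"
      using cb ST by meson
    have "interior S \<inter> interior T = {}"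
      using division_ofD(5)[OF D] ST by blast
    then have "interior (S \<inter> T) = {}" by simp
    then show ?thesis
      unfolding * Int_interval interior_cbox negligible_interval by blast
  qed
  have "(\<Sum>K\<in>D. Sup K - Inf K) = (\<Sum>K\<in>D. measure lebesgue K)"
    using eq by (rule sum.cong[OF refl])
  also have "\<dots> = measure lebesgue (\<Union>D)"
  proof (rule measure_negligible_finite_Union[symmetric])
    show "finite D" using D by blast
    show "S \<in> lmeasurable" if "S \<in> D" for S using cb[OF that] by auto
    show "pairwise (\<lambda>S T. negligible (S \<inter> T)) D" using neg by (auto simp: pairwise_def)
  qed
  also have "\<dots> \<le> measure lebesgue U"
  proof (rule measure_mono_fmeasurable[OF sub _ meas])
    show "\<Union>D \<in> sets lebesgue"
      using D cb by (intro sets.finite_Union) auto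
  qed
  finally show ?thesis .
qed

lemma abs_continuous_on_interval_subset:
  assumes "abs_continuous_on_interval a b x" "{c..d} \<subseteq> {a..b}"
  shows "abs_continuous_on_interval c d x"
  using assms unfolding abs_continuous_on_interval_def by (meson order_trans)

text \<open>
  Redefine the derivative to be \<open>0\<close> on the exceptional null set \<open>N\<close>, which does not change the
  integral.  For a tagged division of \<open>{a..b}\<close>, the Riemann sum minus \<open>x b - x a\<close> splits into one
  error per tagged interval.  At a tag outside \<open>N\<close> differentiability makes the error small relative
  to the length of the interval, as in the classical fundamental theorem.  At a tag in \<open>N\<close> the error
  is just the increment of \<open>x\<close>; the gauge forces these intervals into an open set of small measure
  containing \<open>N\<close>, so absolute continuity makes the sum of their increments small.
\<close>

lemma fundamental_theorem_of_calculus_abs_continuous: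
  fixes x :: "real \<Rightarrow> 'a::banach"
  assumes ab: "a \<le> b" and ac: "abs_continuous_on_interval a b x" and N: "negligible N"
    and der: "\<And>t. t \<in> {a..b} - N \<Longrightarrow> (x has_vector_derivative x' t) (at t within {a..b})"
  shows "(x' has_integral (x b - x a)) {a..b}"
proof (cases "a = b")
  case True
  then show ?thesis using has_integral_refl(2) by simp
next
  case False
  with ab have "a < b" by simp
  define g where "g t = (if t \<in> N then 0 else x' t)" for t
  have "(g has_integral (x b - x a)) {a..b}"
    unfolding has_integral_factor_content_real
  proof (intro allI impI)
    fix e :: real assume e: "e > 0"
    \<comment> \<open>The intervals tagged outside \<open>N\<close> and those tagged in \<open>N\<close> each get half of the error.\<close>
    define c where "c = e / 2"
    have c: "c > 0" using e by (simp add: c_def)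
    have "\<forall>t. \<exists>d>0. t \<in> {a..b} - N \<longrightarrow>
        (\<forall>y\<in>{a..b}. norm (y - t) < d \<longrightarrow> norm (x y - x t - (y - t) *\<^sub>R x' t) \<le> c * norm (y - t))"
      using der[unfolded has_vector_derivative_def has_derivative_within_alt] c by (metis zero_less_one)
    then obtain d where d: "\<And>t. 0 < d t"
      "\<And>t y. \<lbrakk>t \<in> {a..b} - N; y \<in> {a..b}; norm (y - t) < d t\<rbrakk>
                 \<Longrightarrow> norm (x y - x t - (y - t) *\<^sub>R x' t) \<le> c * norm (y - t)"
      by metis
    have "c * (b - a) > 0" using c \<open>a < b\<close> by simp
    then obtain \<delta> where \<delta>: "\<delta> > 0" and small:
      "\<And>D. \<lbrakk>D division_of \<Union>D; \<Union>D \<subseteq> {a..b}; (\<Sum>K\<in>D. Sup K - Inf K) < \<delta>\<rbrakk>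
          \<Longrightarrow> (\<Sum>K\<in>D. norm (x (Sup K) - x (Inf K))) < c * (b - a)"
      using ac unfolding abs_continuous_on_interval_def by meson
    have Nm: "N \<in> sets lebesgue" "emeasure lebesgue N = 0"
      using N by (auto simp: negligible_iff_null_sets null_sets_def)
    obtain U where U: "open U" "N \<subseteq> U" "U - N \<in> lmeasurable" "emeasure lebesgue (U - N) < ennreal \<delta>"
      using sets_lebesgue_outer_open[OF Nm(1) \<delta>] by blast
    have "U = (U - N) \<union> N" using U by blast
    then have Um: "U \<in> lmeasurable"
      using U(3) N by (metis fmeasurable.Un negligible_imp_measurable)
    have "measure lebesgue U = measure lebesgue (U - N)"
      using N by (metis U(3) Um fmeasurableD measure_Diff_null_set negligible_iff_null_sets)
    also have "\<dots> < \<delta>"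
      using U(4) \<delta> by (simp add: emeasure_eq_measure2[OF U(3)] ennreal_less_iff)
    finally have Umeas: "measure lebesgue U < \<delta>" .
    define \<gamma> where "\<gamma> t = (if t \<in> N then U else ball t (d t))" for t
    have "gauge \<gamma>"
      using U d(1) unfolding gauge_def \<gamma>_def by auto
    moreover
    have "norm ((\<Sum>(t,K)\<in>p. measure lborel K *\<^sub>R g t) - (x b - x a)) \<le> e * measure lborel {a..b}"
      if p: "p tagged_division_of {a..b}" and fine: "\<gamma> fine p" for p
    proof -
      have fin: "finite p" using p by blast
      have shape: "\<exists>u v. K = {u..v} \<and> u \<le> t \<and> t \<le> v \<and> a \<le> u \<and> v \<le> b" if "(t, K) \<in> p" for t K
      proof -
        obtain u v where uv: "K = cbox u v" using p \<open>(t,K) \<in> p\<close> by blast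
        have "t \<in> K" "K \<subseteq> {a..b}" using p \<open>(t,K) \<in> p\<close> by blast+
        then show ?thesis using uv by (intro exI[of _ u] exI[of _ v]) auto
      qed
      have tele: "b - a = (\<Sum>(t,K)\<in>p. Sup K - Inf K)" "x b - x a = (\<Sum>(t,K)\<in>p. x (Sup K) - x (Inf K))"
        using additive_tagged_division_1[OF ab, of p "\<lambda>x. x"] additive_tagged_division_1[OF ab, of p x] p
        by auto
      define err where "err = (\<lambda>(t,K). measure lborel K *\<^sub>R g t - (x (Sup K) - x (Inf K)))"
      define q where "q = {tK \<in> p. fst tK \<in> N}"
      have qp: "q \<subseteq> p" by (auto simp: q_def)
      have good: "norm (err tK) \<le> c * (case tK of (t,K) \<Rightarrow> Sup K - Inf K)" if "tK \<in> p - q" for tK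
      proof -
        obtain t K where tK: "tK = (t,K)" "(t,K) \<in> p" "t \<notin> N"
          using \<open>tK \<in> p - q\<close> by (cases tK) (auto simp: q_def)
        obtain u v where K: "K = {u..v}" "u \<le> t" "t \<le> v" "a \<le> u" "v \<le> b"
          using shape[OF tK(2)] by blast
        have uv: "u \<le> v" using K by simp
        have ball: "K \<subseteq> ball t (d t)"
          using fine tK unfolding fine_def \<gamma>_def by fastforce
        have "norm ((v - u) *\<^sub>R x' t - (x v - x u))
            = norm (x u - x t - (u - t) *\<^sub>R x' t - (x v - x t - (v - t) *\<^sub>R x' t))"
          by (auto simp: algebra_simps)
        also have "\<dots> \<le> norm (x u - x t - (u - t) *\<^sub>R x' t) + norm (x v - x t - (v - t) *\<^sub>R x' t)"
          by (rule norm_triangle_ineq4)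
        also have "\<dots> \<le> c * norm (u - t) + c * norm (v - t)"
        proof (intro add_mono d(2))
          have "u \<in> K" "v \<in> K" using K uv by auto
          then show "norm (u - t) < d t" "norm (v - t) < d t"
            using ball by (auto simp: dist_real_def)
        qed (use K tK uv in auto)
        also have "\<dots> = c * (v - u)" using K by (simp add: algebra_simps)
        finally show ?thesis
          using uv tK by (simp add: err_def g_def K)
      qed
      have len: "0 \<le> (case tK of (t,K) \<Rightarrow> Sup K - Inf K)" if "tK \<in> p" for tK
        using shape that by (cases tK) fastforce
      have "(\<Sum>tK\<in>p - q. norm (err tK)) \<le> (\<Sum>tK\<in>p - q. c * (case tK of (t,K) \<Rightarrow> Sup K - Inf K))"
        by (rule sum_mono[OF good])
      also have "\<dots> \<le> (\<Sum>tK\<in>p. c * (case tK of (t,K) \<Rightarrow> Sup K - Inf K))"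
        using fin len c by (intro sum_mono2) auto
      also have "\<dots> = c * (b - a)"
        by (simp add: tele(1) sum_distrib_left)
      finally have sum_good: "(\<Sum>tK\<in>p - q. norm (err tK)) \<le> c * (b - a)" .
      have q_td: "q tagged_division_of (\<Union>(snd ` q))"
        using p qp by (meson tagged_division_of_def tagged_partial_division_of_Union_self
            tagged_partial_division_subset)
      let ?D = "snd ` q"
      have D: "?D division_of \<Union>?D" by (rule division_of_tagged_division[OF q_td])
      have "K \<subseteq> U" if "K \<in> ?D" for K
        using that fine unfolding q_def fine_def \<gamma>_def by fastforce
      then have "(\<Sum>K\<in>?D. Sup K - Inf K) < \<delta>"
        using sum_lengths_division_le_measure[OF D _ Um] Umeas by fastforce
      moreover have "\<Union>?D \<subseteq> {a..b}" using p qp by fastforce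
      ultimately have "(\<Sum>K\<in>?D. norm (x (Sup K) - x (Inf K))) < c * (b - a)"
        by (intro small D)
      moreover have "(\<Sum>(t,K)\<in>q. norm (x (Sup K) - x (Inf K))) = (\<Sum>K\<in>?D. norm (x (Sup K) - x (Inf K)))"
      proof -
        \<comment> \<open>Distinct tags may share a degenerate interval, on which the increment is \<open>0\<close>.  The
          auxiliary \<open>l\<close> also vanishes at the empty set, where \<open>Sup\<close> and \<open>Inf\<close> are unspecified.\<close>
        define l where "l K = (if K = {} then 0 else norm (x (Sup K) - x (Inf K)))" for K
        have ne: "K \<noteq> {}" if "(t, K) \<in> q" for t K
          using tagged_division_ofD(2)[OF q_td that] by blast
        have "(\<Sum>(t,K)\<in>q. norm (x (Sup K) - x (Inf K))) = (\<Sum>(t,K)\<in>q. l K)"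
          using ne by (intro sum.cong) (auto simp: l_def)
        also have "\<dots> = (\<Sum>K\<in>?D. l K)"
        proof (rule sum.over_tagged_division_lemma[OF q_td])
          fix u v :: real assume "box u v = {}"
          then have "u \<ge> v" by simp
          then show "l (cbox u v) = 0" by (cases "u = v") (auto simp: l_def)
        qed
        also have "\<dots> = (\<Sum>K\<in>?D. norm (x (Sup K) - x (Inf K)))"
          using ne by (intro sum.cong) (auto simp: l_def)
        finally show ?thesis .
      qed
      moreover have "(\<Sum>tK\<in>q. norm (err tK)) = (\<Sum>(t,K)\<in>q. norm (x (Sup K) - x (Inf K)))"
        by (rule sum.cong) (auto simp: err_def q_def g_def norm_minus_commute)
      ultimately have sum_bad: "(\<Sum>tK\<in>q. norm (err tK)) \<le> c * (b - a)" by simp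
      have "(\<Sum>(t,K)\<in>p. measure lborel K *\<^sub>R g t) - (x b - x a) = (\<Sum>tK\<in>p. err tK)"
        by (simp add: tele(2) err_def split_def sum_subtractf)
      also have "norm \<dots> \<le> (\<Sum>tK\<in>p. norm (err tK))" by (rule norm_sum)
      also have "\<dots> = (\<Sum>tK\<in>p - q. norm (err tK)) + (\<Sum>tK\<in>q. norm (err tK))"
        using sum.subset_diff[OF qp fin] .
      also have "\<dots> \<le> e * measure lborel {a..b}"
        using sum_good sum_bad ab by (simp add: c_def field_simps)
      finally show ?thesis .
    qed
    ultimately show "\<exists>d. gauge d \<and> (\<forall>p. p tagged_division_of {a..b} \<and> d fine p \<longrightarrow>
        norm ((\<Sum>(t,K)\<in>p. measure lborel K *\<^sub>R g t) - (x b - x a)) \<le> e * measure lborel {a..b})"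
      by (intro exI[of _ \<gamma>]) simp
  qed
  then show ?thesis
    by (rule has_integral_spike[OF N, rotated]) (simp add: g_def)
qed

section \<open>Gronwall's inequality\<close>

text \<open>
  The right-hand side \<open>H t\<close> of the integral inequality satisfies \<open>H' \<le> L * H + \<epsilon>\<close>, so
  \<open>H + \<epsilon> / L\<close> divided by \<open>exp (L * (t - a))\<close> cannot increase.
\<close>

lemma gronwall_integral:
  fixes h :: "real \<Rightarrow> real"
  assumes L: "L > 0" and cont: "continuous_on {a..b} h"
    and le: "\<And>t. t \<in> {a..b} \<Longrightarrow> h t \<le> integral {a..t} (\<lambda>s. L * h s + \<epsilon>)"
    and t: "t \<in> {a..b}"
  shows "h t \<le> \<epsilon> * ((exp (L * (t - a)) - 1) / L)"
proof -
  define H where "H t = integral {a..t} (\<lambda>s. L * h s + \<epsilon>)" for t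
  define w where "w t = (H t + \<epsilon> / L) * exp (- L * (t - a))" for t
  have cont': "continuous_on {a..b} (\<lambda>s. L * h s + \<epsilon>)"
    by (intro continuous_intros cont)
  have H': "(H has_real_derivative (L * h s + \<epsilon>)) (at s within {a..b})" if "s \<in> {a..b}" for s
    unfolding H_def by (rule integral_has_real_derivative[OF cont' that])
  have contH: "continuous_on {a..b} H"
    using H' by (rule DERIV_continuous_on)
  have "w t \<le> w a"
  proof (rule DERIV_nonpos_imp_decreasing_open[where f = w])
    show "a \<le> t" using t by simp
    show "continuous_on {a..t} w"
      unfolding w_def using t by (intro continuous_intros continuous_on_subset[OF contH]) auto
    fix s assume s: "a < s" "s < t"
    then have sab: "s \<in> {a..b}" "s \<in> {a<..<b}" using t by auto
    have "(H has_real_derivative (L * h s + \<epsilon>)) (at s)"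
      using H'[OF sab(1)] at_within_Icc_at[of a s b] sab(2) by simp
    then have "(w has_real_derivative
        (L * h s + \<epsilon>) * exp (- L * (s - a)) + exp (- L * (s - a)) * (- L) * (H s + \<epsilon> / L)) (at s)"
      unfolding w_def by (auto intro!: derivative_eq_intros)
    moreover have "(L * h s + \<epsilon>) * exp (- L * (s - a)) + exp (- L * (s - a)) * (- L) * (H s + \<epsilon> / L)
        = L * (h s - H s) * exp (- L * (s - a))"
      using L by (simp add: algebra_simps)
    moreover have "\<dots> \<le> 0"
      using le[OF sab(1)] L by (simp add: H_def mult_le_0_iff)
    ultimately show "\<exists>y. (w has_real_derivative y) (at s) \<and> y \<le> 0" by auto
  qed
  then have "(H t + \<epsilon> / L) * exp (- L * (t - a)) \<le> \<epsilon> / L"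
    by (simp add: w_def H_def)
  then have "(H t + \<epsilon> / L) * exp (- L * (t - a)) * exp (L * (t - a)) \<le> \<epsilon> / L * exp (L * (t - a))"
    by (intro mult_right_mono) auto
  moreover have "exp (- L * (t - a)) * exp (L * (t - a)) = 1"
    by (simp flip: exp_add)
  ultimately have "H t + \<epsilon> / L \<le> \<epsilon> / L * exp (L * (t - a))"
    by (simp only: mult.assoc mult_1_right)
  then have "H t \<le> \<epsilon> * ((exp (L * (t - a)) - 1) / L)"
    by (simp add: diff_divide_distrib right_diff_distrib)
  then show ?thesis using le[OF t] by (simp add: H_def)
qed

text \<open>
  The comparison principle behind the error bound: \<open>y\<close> plays the role of an approximate solution with
  a derivative everywhere, \<open>x\<close> that of an exact solution in the sense of Caratheodory.  Both are
  integrals of their derivatives, so the pointwise bound on the difference of the derivatives turns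
  into the integral inequality for \<open>norm (y - x)\<close>.
\<close>

lemma abs_continuous_gronwall:
  fixes x y :: "real \<Rightarrow> 'a::banach"
  assumes L: "L > 0" and N: "negligible N" and init: "y a = x a"
    and ac: "abs_continuous_on_interval a b x"
    and y': "\<And>t. t \<in> {a..b} \<Longrightarrow> (y has_vector_derivative y' t) (at t within {a..b})"
    and x': "\<And>t. t \<in> {a..b} - N \<Longrightarrow> (x has_vector_derivative x' t) (at t within {a..b})"
    and le: "\<And>t. t \<in> {a..b} - N \<Longrightarrow> norm (y' t - x' t) \<le> L * norm (y t - x t) + \<epsilon>"
    and t: "t \<in> {a..b}"
  shows "norm (y t - x t) \<le> \<epsilon> * ((exp (L * (t - a)) - 1) / L)"
proof -
  have int: "((\<lambda>s. y' s - x' s) has_integral (y u - x u)) {a..u}" if u: "u \<in> {a..b}" for u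
  proof -
    have sub: "{a..u} \<subseteq> {a..b}" and au: "a \<le> u" using u by auto
    have "(y' has_integral (y u - y a)) {a..u}"
      using sub by (intro fundamental_theorem_of_calculus au)
        (auto intro: has_vector_derivative_within_subset[OF y'])
    moreover have "(x' has_integral (x u - x a)) {a..u}"
      using sub by (intro fundamental_theorem_of_calculus_abs_continuous[OF au _ N]
          abs_continuous_on_interval_subset[OF ac])
        (auto intro: has_vector_derivative_within_subset[OF x'])
    ultimately have "((\<lambda>s. y' s - x' s) has_integral ((y u - y a) - (x u - x a))) {a..u}"
      by (rule has_integral_diff)
    then show ?thesis by (simp add: init)
  qed
  have cont: "continuous_on {a..b} (\<lambda>u. norm (y u - x u))"
  proof -
    have "(\<lambda>s. y' s - x' s) integrable_on {a..b}"
      using int[of b] t by (auto simp: integrable_on_def)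
    then have "continuous_on {a..b} (\<lambda>u. integral {a..u} (\<lambda>s. y' s - x' s))"
      by (rule indefinite_integral_continuous_1)
    then have "continuous_on {a..b} (\<lambda>u. y u - x u)"
      by (rule continuous_on_eq) (use int in \<open>blast intro: integral_unique\<close>)
    then show ?thesis by (rule continuous_on_norm)
  qed
  show ?thesis
  proof (rule gronwall_integral[OF L cont _ t])
    fix u assume u: "u \<in> {a..b}"
    \<comment> \<open>The bound on the integrand may fail on the null set, so both sides are replaced by \<open>0\<close> there.\<close>
    define z where "z s = (if s \<in> N then 0 else y' s - x' s)" for s
    have z: "(z has_integral (y u - x u)) {a..u}"
      by (rule has_integral_spike[OF N _ int[OF u]]) (simp add: z_def)
    define B where "B s = L * norm (y s - x s) + \<epsilon>" for s
    define B' where "B' s = (if s \<in> N then 0 else B s)" for s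
    have "continuous_on {a..u} B"
      unfolding B_def using u by (intro continuous_intros continuous_on_subset[OF cont]) auto
    then have B: "B integrable_on {a..u}" by (rule integrable_continuous_real)
    have B': "B' integrable_on {a..u}"
      by (rule integrable_spike[OF B N]) (simp add: B'_def)
    have "norm (integral {a..u} z) \<le> integral {a..u} B'"
    proof (rule integral_norm_bound_integral[OF _ B'])
      show "z integrable_on {a..u}" using z by blast
      show "norm (z s) \<le> B' s" if "s \<in> {a..u}" for s
        using le[of s] that u by (auto simp: z_def B'_def B_def)
    qed
    also have "\<dots> = integral {a..u} B"
      by (rule integral_spike[OF N]) (simp add: B'_def)
    finally show "norm (y u - x u) \<le> integral {a..u} (\<lambda>s. L * norm (y s - x s) + \<epsilon>)"
      using integral_unique[OF z] by (simp add: B_def[abs_def])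
  qed
qed

section \<open>Smoothness of the network trajectory\<close>

lemma C1_differentiable_on_bounded_linear:
  assumes "bounded_linear A" "f C1_differentiable_on S"
  shows "(\<lambda>t. A (f t)) C1_differentiable_on S"
proof -
  obtain D where "\<And>t. t \<in> S \<Longrightarrow> (f has_vector_derivative D t) (at t)" "continuous_on S D"
    using assms(2) unfolding C1_differentiable_on_def by blast
  then show ?thesis
    unfolding C1_differentiable_on_def
    by (intro exI[of _ "\<lambda>t. A (D t)"])
      (auto intro: bounded_linear.continuous_on[OF assms(1)]
        bounded_linear.has_vector_derivative[OF assms(1)])
qed

lemma C1_differentiable_on_sum:
  assumes "\<And>i. i \<in> I \<Longrightarrow> f i C1_differentiable_on S"
  shows "(\<lambda>t. \<Sum>i\<in>I. f i t) C1_differentiable_on S"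
  using assms by (induction I rule: infinite_finite_induct) auto

lemma C1_differentiable_on_vec:
  fixes f :: "real \<Rightarrow> real^'n"
  shows "f C1_differentiable_on S \<longleftrightarrow> (\<forall>i. (\<lambda>t. f t $ i) C1_differentiable_on S)"
proof (intro iffI allI)
  show "(\<lambda>t. f t $ i) C1_differentiable_on S" if "f C1_differentiable_on S" for i
    using bounded_linear_vec_nth that by (rule C1_differentiable_on_bounded_linear)
  assume "\<forall>i. (\<lambda>t. f t $ i) C1_differentiable_on S"
  then have "(\<lambda>t. \<Sum>i\<in>UNIV. f t $ i *\<^sub>R axis i 1) C1_differentiable_on S"
    by (intro C1_differentiable_on_sum C1_differentiable_on_scaleR) auto
  also have "(\<lambda>t. \<Sum>i\<in>UNIV. f t $ i *\<^sub>R axis i 1) = f"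
    by (rule ext) (simp add: basis_expansion flip: scalar_mult_eq_scaleR)
  finally show "f C1_differentiable_on S" .
qed

text \<open>
  The chain rule is applied directly: \<open>C1_differentiable_compose\<close> asks the inner function to have
  finite fibres, and the pre-activation of a neuron may well be constant in time.
\<close>

lemma C1_differentiable_on_tanh:
  fixes f :: "real \<Rightarrow> real"
  assumes "f C1_differentiable_on S"
  shows "(\<lambda>t. tanh (f t)) C1_differentiable_on S"
proof -
  obtain D where D: "\<And>t. t \<in> S \<Longrightarrow> (f has_vector_derivative D t) (at t)" "continuous_on S D"
    using assms unfolding C1_differentiable_on_def by blast
  have "continuous_on S f"
    using D(1) by (meson continuous_at_imp_continuous_on has_vector_derivative_continuous)
  then have "continuous_on S (\<lambda>t. (1 - tanh (f t) ^ 2) * D t)"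
    by (intro continuous_intros D(2)) auto
  moreover have "((\<lambda>t. tanh (f t)) has_vector_derivative (1 - tanh (f t) ^ 2) * D t) (at t)" if "t \<in> S" for t
    using D(1)[OF that] unfolding has_real_derivative_iff_has_vector_derivative[symmetric]
    by (auto intro!: derivative_eq_intros)
  ultimately show ?thesis
    unfolding C1_differentiable_on_def
    by (intro exI[of _ "\<lambda>t. (1 - tanh (f t) ^ 2) * D t"]) simp
qed

lemma C1_differentiable_on_affine_layer:
  assumes "f C1_differentiable_on S"
  shows "(\<lambda>t. affine_layer l (f t)) C1_differentiable_on S"
  unfolding affine_layer_def using assms
  by (intro C1_differentiable_on_add C1_differentiable_on_const
      C1_differentiable_on_bounded_linear[OF matrix_vector_mul_bounded_linear])

lemma C1_differentiable_on_tanh_vec: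
  assumes "f C1_differentiable_on S"
  shows "(\<lambda>t. tanh_vec (f t)) C1_differentiable_on S"
  using assms unfolding C1_differentiable_on_vec tanh_vec_def
  by (auto intro: C1_differentiable_on_tanh)

lemma C1_differentiable_on_mlp_eval:
  assumes "f C1_differentiable_on S"
  shows "(\<lambda>t. mlp_eval N (f t)) C1_differentiable_on S"
  unfolding mlp_eval_def split_def
  by (intro C1_differentiable_on_affine_layer C1_differentiable_on_tanh_vec assms)

lemma C1_differentiable_on_t_norm: "t_norm P \<theta> x0 C1_differentiable_on S"
  unfolding t_norm_def[abs_def] divide_inverse
  by (intro derivative_intros)

text \<open>
  Only the first input of the trunk depends on time; this isolates it.
\<close>

lemma vector_Cons_nth:
  "(vector (c # l) :: 'a::zero^'n::{finite,plus,one}) $ i = (if i = 1 then c else (vector (0 # l) :: 'a^'n::{finite,plus,one}) $ i)"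
  by (simp add: vector_def)

lemma C1_differentiable_on_trunk_output: "trunk_output P \<theta> x0 C1_differentiable_on S"
proof -
  have "(\<lambda>t. vector (t_norm P \<theta> x0 t # l) :: real^8) C1_differentiable_on S" for l
    unfolding C1_differentiable_on_vec
  proof
    show "(\<lambda>t. (vector (t_norm P \<theta> x0 t # l) :: real^8) $ i) C1_differentiable_on S" for i
      by (subst vector_Cons_nth) (cases "i = 1"; simp add: C1_differentiable_on_t_norm)
  qed
  then show ?thesis
    unfolding trunk_output_def[abs_def] split_def by (intro C1_differentiable_on_mlp_eval)
qed

lemma C1_differentiable_on_vector_3:
  fixes f g h :: "real \<Rightarrow> real"
  assumes "f C1_differentiable_on S" "g C1_differentiable_on S" "h C1_differentiable_on S"
  shows "(\<lambda>t. vector [f t, g t, h t] :: real^3) C1_differentiable_on S"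
  using assms by (simp add: C1_differentiable_on_vec forall_3)

lemma C1_differentiable_on_trunk_component: "(\<lambda>t. trunk_output P \<theta> x0 t $ i) C1_differentiable_on S"
  using C1_differentiable_on_trunk_output C1_differentiable_on_vec by blast

lemma C1_differentiable_on_NN:
  "r_NN P \<theta> x0 C1_differentiable_on S"
  "v_NN P \<theta> x0 C1_differentiable_on S"
  "m_NN P \<theta> x0 C1_differentiable_on S"
  unfolding r_NN_def[abs_def] v_NN_def[abs_def] m_NN_def[abs_def] NN_r_def NN_v_def NN_m_def Let_def
  by (intro derivative_intros C1_differentiable_on_t_norm C1_differentiable_on_vector_3
      C1_differentiable_on_trunk_component)+

lemma C1_imp_has_vector_derivative_within:
  assumes "f C1_differentiable_on UNIV"
  shows "(f has_vector_derivative vector_derivative f (at t)) (at t within S)"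
  using assms unfolding C1_differentiable_on_eq
  by (simp add: has_vector_derivative_at_within vector_derivative_works)

lemma C1_imp_vector_derivative_within:
  assumes "f C1_differentiable_on UNIV" "a < b" "t \<in> {a..b}"
  shows "vector_derivative f (at t within {a..b}) = vector_derivative f (at t)"
  using assms C1_imp_has_vector_derivative_within[OF assms(1), of t UNIV]
  by (intro vector_derivative_at_within_ivl) auto

text \<open>
  Built from the componentwise two-sided derivatives, because the residual is defined through the
  derivatives of the three components.  The network formulas make sense for all real times, so at the
  end points of the flight interval these agree with the one-sided derivatives.
\<close>

definition x_NN' :: "problem \<Rightarrow> weights \<Rightarrow> state \<Rightarrow> real \<Rightarrow> state" where
  "x_NN' P \<theta> x0 t = (vector_derivative (r_NN P \<theta> x0) (at t),
     vector_derivative (v_NN P \<theta> x0) (at t), vector_derivative (m_NN P \<theta> x0) (at t))"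

lemma x_NN_has_vector_derivative:
  "(x_NN P \<theta> x0 has_vector_derivative x_NN' P \<theta> x0 t) (at t within S)"
  unfolding x_NN_def[abs_def] x_NN'_def
  by (intro has_vector_derivative_Pair C1_imp_has_vector_derivative_within C1_differentiable_on_NN)

lemma continuous_on_x_NN':
  "continuous_on S (x_NN' P \<theta> x0)"
  using C1_differentiable_on_NN[where S=S] unfolding x_NN'_def[abs_def] C1_differentiable_on_eq
  by (intro continuous_on_Pair) auto

lemma residual_eq:
  assumes t: "t \<in> flight_interval P \<theta> x0" and "t_0 P < t_f P \<theta> x0"
  shows "residual P \<theta> x0 t = x_NN' P \<theta> x0 t - dynamics P (x_NN P \<theta> x0 t) (u_NN P \<theta> x0 t)"
  using assms unfolding flight_interval_def
  by (simp add: residual_def res_r_def res_v_def res_m_def x_NN'_def dynamics_def x_NN_def u_NN_def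
      flight_interval_def C1_imp_vector_derivative_within C1_differentiable_on_NN)

section \<open>The controlled dynamics\<close>

lemma thrust_bounds:
  assumes "0 \<le> T_max P" shows "0 \<le> thrust P \<theta> x0 t" "thrust P \<theta> x0 t \<le> T_max P"
  using assms by (auto simp: thrust_def clip_def)

lemma norm_thrust_dir: "lambda_v P \<theta> x0 t \<noteq> 0 \<Longrightarrow> norm (thrust_dir P \<theta> x0 t) = 1"
  by (simp add: thrust_dir_def)

text \<open>
  Gravity and the mass flow cancel in a difference of rates at the same control.  What remains is
  \<open>v - v'\<close> in the position rate and \<open>T * (m' - m) / (m * m')\<close> times a unit vector in the velocity
  rate, and both masses are at least \<open>m_dry\<close>.
\<close>

lemma dynamics_lipschitz:
  assumes md: "0 < m_dry P" and T: "0 \<le> T" "T \<le> T_max P" and i: "norm i = 1"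
  shows "(L_f P)-lipschitz_on {x. m_dry P \<le> mass_of x} (\<lambda>x. dynamics P x (T, i))"
proof (rule lipschitz_onI)
  have K: "0 \<le> T_max P / (m_dry P)\<^sup>2" using T by simp
  then show "0 \<le> L_f P" by (simp add: L_f_def)
  fix x y :: state assume "x \<in> {x. m_dry P \<le> mass_of x}" "y \<in> {x. m_dry P \<le> mass_of x}"
  moreover obtain r v m r' v' m' where xy: "x = (r, v, m)" "y = (r', v', m')"
    by (cases x, cases y) auto
  ultimately have m: "m_dry P \<le> m" "m_dry P \<le> m'" by auto
  have dv: "norm (v - v') \<le> norm (x - y)"
    unfolding xy using order_trans[OF norm_fst_le[of "v - v'" "m - m'"] norm_snd_le[of _ "r - r'"]] by simp
  have dm: "\<bar>m - m'\<bar> \<le> norm (x - y)"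
    unfolding xy using order_trans[OF norm_snd_le[of "m - m'" "v - v'"] norm_snd_le[of _ "r - r'"]] by simp
  have pos: "0 < m" "0 < m'" using m md by auto
  have "T / m - T / m' = T * (m' - m) / (m * m')"
    using pos by (simp add: field_simps)
  then have "\<bar>T / m - T / m'\<bar> = T * \<bar>m - m'\<bar> / (m * m')"
    using pos T by (simp add: abs_mult abs_minus_commute)
  also have "\<dots> \<le> T_max P * \<bar>m - m'\<bar> / (m_dry P)\<^sup>2"
    using m md T pos by (intro frac_le mult_mono) (auto simp: power2_eq_square intro: mult_mono)
  also have "\<dots> \<le> T_max P / (m_dry P)\<^sup>2 * norm (x - y)"
    using mult_left_mono[OF dm K] by simp
  finally have acc: "\<bar>T / m - T / m'\<bar> \<le> T_max P / (m_dry P)\<^sup>2 * norm (x - y)" .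
  have "dynamics P x (T, i) - dynamics P y (T, i) = (v - v', (T / m - T / m') *\<^sub>R i, 0)"
    by (simp add: dynamics_def xy scaleR_diff_left)
  also have "norm \<dots> \<le> norm (v - v') + norm ((T / m - T / m') *\<^sub>R i, 0::real)"
    by (rule norm_Pair_le)
  also have "norm ((T / m - T / m') *\<^sub>R i, 0::real) = \<bar>T / m - T / m'\<bar>"
    by (simp add: norm_Pair i)
  also have "norm (v - v') + \<dots> \<le> L_f P * norm (x - y)"
    using dv acc by (simp add: L_f_def algebra_simps)
  finally show "dist (dynamics P x (T, i)) (dynamics P y (T, i)) \<le> L_f P * dist x y"
    by (simp add: dist_norm)
qed

section \<open>The residual is bounded by its supremum\<close>

text \<open>
  Up to the factor \<open>s_lambda_v\<close>, \<open>lambda_v\<close> is the affine curve \<open>a_0 - s *\<^sub>R a_1\<close> in the normalized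
  time \<open>s\<close>; two distinct zeros would force \<open>a_1 = 0\<close>, hence \<open>a_0 = 0\<close> and a curve that vanishes
  identically.
\<close>

lemma finite_lambda_v_zeros:
  assumes "t_0 P < t_f P \<theta> x0" and nz: "lambda_v P \<theta> x0 t1 \<noteq> 0"
  shows "finite {t. lambda_v P \<theta> x0 t = 0}"
proof -
  have uniq: "s = t" if "lambda_v P \<theta> x0 s = 0" "lambda_v P \<theta> x0 t = 0" for s t
  proof -
    have k: "s_lambda_v P \<noteq> 0" using nz by (auto simp: lambda_v_def)
    with that have "a_0 P \<theta> x0 = t_norm P \<theta> x0 s *\<^sub>R a_1 P \<theta> x0" "a_0 P \<theta> x0 = t_norm P \<theta> x0 t *\<^sub>R a_1 P \<theta> x0"
      by (auto simp: lambda_v_def)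
    moreover from this(1) nz have "a_1 P \<theta> x0 \<noteq> 0" by (auto simp: lambda_v_def)
    ultimately have "t_norm P \<theta> x0 s = t_norm P \<theta> x0 t" by simp
    then show ?thesis using assms(1) by (simp add: t_norm_def)
  qed
  have "{t. lambda_v P \<theta> x0 t = 0} \<subseteq> {SOME t. lambda_v P \<theta> x0 t = 0}"
    using uniq by (auto intro: someI2)
  then show ?thesis by (rule finite_subset) simp
qed

text \<open>
  The work lies in showing that the supremum is taken over a bounded set.  The residual splits into
  a part that is continuous in time, hence bounded on the compact flight interval, and the
  contribution of the control.  The latter need not be continuous where \<open>lambda_v\<close> vanishes, but is
  bounded because the thrust is clipped and the mass stays above \<open>m_dry\<close>.
\<close>

lemma norm_residual_le_eps_inf:
  assumes val: "valid_problem P" and tf: "t_0 P < t_f P \<theta> x0"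
    and mass: "\<And>t. t \<in> flight_interval P \<theta> x0 \<Longrightarrow> m_dry P \<le> m_NN P \<theta> x0 t"
    and t: "t \<in> flight_interval P \<theta> x0" "lambda_v P \<theta> x0 t \<noteq> 0"
  shows "norm (residual P \<theta> x0 t) \<le> eps_inf P \<theta> x0"
proof -
  let ?I = "flight_interval P \<theta> x0"
  have pos: "0 < T_max P" "0 < m_dry P" "0 < I_sp P * g_0 P"
    using val by (auto simp: valid_problem_def)
  define c where "c s = x_NN' P \<theta> x0 s - (v_NN P \<theta> x0 s, grav P, 0)" for s
  have "continuous_on ?I (v_NN P \<theta> x0)"
    using C1_differentiable_on_NN(2)[of P \<theta> x0 ?I]
    by (meson C1_diff_imp_diff differentiable_imp_continuous_on)
  then have "continuous_on ?I c"
    unfolding c_def[abs_def] by (intro continuous_intros continuous_on_x_NN')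
  then have "bounded (c ` ?I)"
    by (intro compact_imp_bounded compact_continuous_image) (auto simp: flight_interval_def)
  then obtain C where C: "\<And>s. s \<in> ?I \<Longrightarrow> norm (c s) \<le> C"
    unfolding bounded_iff by auto
  have bound: "norm (residual P \<theta> x0 s) \<le> C + (T_max P / m_dry P + T_max P / (I_sp P * g_0 P))"
    if s: "s \<in> ?I" "lambda_v P \<theta> x0 s \<noteq> 0" for s
  proof -
    let ?T = "thrust P \<theta> x0 s" and ?m = "m_NN P \<theta> x0 s"
    let ?d = "(0, (?T / ?m) *\<^sub>R thrust_dir P \<theta> x0 s, - ?T / (I_sp P * g_0 P)) :: state"
    have T: "0 \<le> ?T" "?T \<le> T_max P" using thrust_bounds pos by simp_all
    have m: "m_dry P \<le> ?m" using mass s by blast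
    have "residual P \<theta> x0 s = c s - ?d"
      unfolding residual_eq[OF s(1) tf] c_def dynamics_def x_NN_def u_NN_def by simp
    moreover have "norm ?d \<le> T_max P / m_dry P + T_max P / (I_sp P * g_0 P)"
    proof -
      have "norm ?d = norm ((?T / ?m) *\<^sub>R thrust_dir P \<theta> x0 s, - ?T / (I_sp P * g_0 P))"
        by (simp add: norm_Pair)
      also have "\<dots> \<le> norm ((?T / ?m) *\<^sub>R thrust_dir P \<theta> x0 s) + norm (- ?T / (I_sp P * g_0 P))"
        by (rule norm_Pair_le)
      also have "norm ((?T / ?m) *\<^sub>R thrust_dir P \<theta> x0 s) = ?T / ?m"
        using T m pos by (simp add: norm_thrust_dir[OF s(2)])
      also have "norm (- ?T / (I_sp P * g_0 P)) = ?T / (I_sp P * g_0 P)"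
        using T pos by simp
      also have "?T / ?m + ?T / (I_sp P * g_0 P) \<le> T_max P / m_dry P + T_max P / (I_sp P * g_0 P)"
        using T m pos by (intro add_mono frac_le) auto
      finally show ?thesis .
    qed
    ultimately show ?thesis
      using C[OF s(1)] norm_triangle_ineq4[of "c s" ?d] by simp
  qed
  show ?thesis
    unfolding eps_inf_def using t bound
    by (intro cSUP_upper bdd_aboveI2[where M="C + (T_max P / m_dry P + T_max P / (I_sp P * g_0 P))"]) auto
qed

section \<open>The error bound\<close>

theorem theorem5p3:
  fixes P :: problem and \<theta> :: weights and x_true :: "state \<Rightarrow> real \<Rightarrow> state"
  assumes "valid_problem P"
    and "\<forall>x0\<in>initial_states P. t_0 P < t_f P \<theta> x0"
    and "\<forall>x0\<in>initial_states P. \<exists>t\<in>flight_interval P \<theta> x0. lambda_v P \<theta> x0 t \<noteq> 0"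
    and "\<forall>x0\<in>initial_states P. is_true_trajectory P \<theta> x0 (x_true x0)"
    and "\<forall>x0\<in>initial_states P. \<forall>t\<in>flight_interval P \<theta> x0.
           mass_of (x_NN P \<theta> x0 t) \<in> {m_dry P..mass_of x0} \<and>
           mass_of (x_true x0 t) \<in> {m_dry P..mass_of x0}"
  shows "(\<forall>T i. 0 \<le> T \<and> T \<le> T_max P \<and> norm i = 1 \<longrightarrow>
            (L_f P)-lipschitz_on {x. m_dry P \<le> mass_of x} (\<lambda>x. dynamics P x (T, i)))
       \<and> (\<forall>x0\<in>initial_states P. \<forall>t\<in>flight_interval P \<theta> x0.
            norm (x_NN P \<theta> x0 t - x_true x0 t)
              \<le> eps_inf P \<theta> x0 * ((exp (L_f P * (t - t_0 P)) - 1) / L_f P))"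
proof (intro conjI allI impI ballI)
  have pos: "0 < T_max P" "0 < m_dry P" using assms(1) by (auto simp: valid_problem_def)
  then have L: "0 < L_f P" by (simp add: L_f_def add_pos_nonneg)
  show "(L_f P)-lipschitz_on {x. m_dry P \<le> mass_of x} (\<lambda>x. dynamics P x (T, i))"
    if "0 \<le> T \<and> T \<le> T_max P \<and> norm i = 1" for T i
    using that pos by (intro dynamics_lipschitz) auto
  fix x0 t assume x0: "x0 \<in> initial_states P" and t: "t \<in> flight_interval P \<theta> x0"
  define x where "x = x_true x0"
  let ?I = "flight_interval P \<theta> x0" and ?y = "x_NN P \<theta> x0" and ?u = "u_NN P \<theta> x0"
  have tf: "t_0 P < t_f P \<theta> x0" using assms(2) x0 by blast
  have mass: "m_dry P \<le> mass_of (?y s)" "m_dry P \<le> mass_of (x s)" if "s \<in> ?I" for s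
    using assms(5) x0 that by (auto simp: x_def)
  have traj: "is_true_trajectory P \<theta> x0 x" using assms(4) x0 by (simp add: x_def)
  obtain N where N: "negligible N" and ode: "\<And>s. s \<in> ?I - N \<Longrightarrow>
      (x has_vector_derivative dynamics P (x s) (?u s)) (at s within ?I)"
  proof -
    have "AE s in lebesgue. s \<in> ?I \<longrightarrow> (x has_vector_derivative dynamics P (x s) (?u s)) (at s within ?I)"
      using traj by (simp add: is_true_trajectory_def)
    then obtain N where "N \<in> null_sets lebesgue"
      "{s \<in> space lebesgue. \<not> (s \<in> ?I \<longrightarrow>
          (x has_vector_derivative dynamics P (x s) (?u s)) (at s within ?I))} \<subseteq> N"
      unfolding eventually_ae_filter by blast
    then show ?thesis by (intro that[of N]) (auto simp: negligible_iff_null_sets)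
  qed
  let ?Z = "{s. lambda_v P \<theta> x0 s = 0}"
  have "finite ?Z" using assms(3) x0 finite_lambda_v_zeros[OF tf] by blast
  then have NZ: "negligible (N \<union> ?Z)" using N by (simp add: negligible_Un negligible_finite)
  show "norm (?y t - x_true x0 t) \<le> eps_inf P \<theta> x0 * ((exp (L_f P * (t - t_0 P)) - 1) / L_f P)"
    unfolding x_def[symmetric]
  proof (rule abs_continuous_gronwall[OF L NZ])
    \<comment> \<open>All correction terms of the ansatz carry the factor \<open>t_norm\<close>, which is \<open>0\<close> at \<open>t_0\<close>.\<close>
    show "?y (t_0 P) = x (t_0 P)"
      using traj by (simp add: is_true_trajectory_def x_NN_def r_NN_def v_NN_def m_NN_def t_norm_def)
    show "abs_continuous_on_interval (t_0 P) (t_f P \<theta> x0) x"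
      using traj by (simp add: is_true_trajectory_def)
    show "t \<in> {t_0 P..t_f P \<theta> x0}" using t by (simp add: flight_interval_def)
    fix s assume s: "s \<in> {t_0 P..t_f P \<theta> x0}"
    show "(?y has_vector_derivative x_NN' P \<theta> x0 s) (at s within {t_0 P..t_f P \<theta> x0})"
      by (rule x_NN_has_vector_derivative)
  next
    fix s assume "s \<in> {t_0 P..t_f P \<theta> x0} - (N \<union> ?Z)"
    then have s: "s \<in> ?I" "s \<notin> N" "lambda_v P \<theta> x0 s \<noteq> 0"
      by (auto simp: flight_interval_def)
    show "(x has_vector_derivative dynamics P (x s) (?u s)) (at s within {t_0 P..t_f P \<theta> x0})"
      using ode[of s] s by (simp add: flight_interval_def)
    have lip: "(L_f P)-lipschitz_on {x. m_dry P \<le> mass_of x} (\<lambda>x. dynamics P x (?u s))"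
      unfolding u_NN_def using thrust_bounds[of P] norm_thrust_dir[OF s(3)] pos
      by (intro dynamics_lipschitz) auto
    have "x_NN' P \<theta> x0 s - dynamics P (x s) (?u s)
        = residual P \<theta> x0 s + (dynamics P (?y s) (?u s) - dynamics P (x s) (?u s))"
      by (simp add: residual_eq[OF s(1) tf])
    also have "norm \<dots> \<le> norm (residual P \<theta> x0 s) + norm (dynamics P (?y s) (?u s) - dynamics P (x s) (?u s))"
      by (rule norm_triangle_ineq)
    also have "norm (dynamics P (?y s) (?u s) - dynamics P (x s) (?u s)) \<le> L_f P * norm (?y s - x s)"
      using lipschitz_onD[OF lip, of "?y s" "x s"] mass[OF s(1)] by (simp add: dist_norm)
    also have "norm (residual P \<theta> x0 s) \<le> eps_inf P \<theta> x0"
      using mass(1) by (intro norm_residual_le_eps_inf[OF assms(1) tf _ s(1,3)]) (simp add: x_NN_def)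
    finally show "norm (x_NN' P \<theta> x0 s - dynamics P (x s) (?u s))
        \<le> L_f P * norm (?y s - x s) + eps_inf P \<theta> x0" by simp
  qed
qed

end
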